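(* In the setting described in the context with all transition matrices symmetric (so all canonical tuples are real), fix $r$ and $k$, fix $\Lambda_{r}^{(d)}$ and all columns of $U_{r}^{(d)}\in\mathbb{R}^{m\times n}$ except the $k$-th. Let $[U_r^{(d)}]_{-k}\in\mathbb{R}^{m\times(n-1)}$ be $U_r^{(d)}$ with its $k$-th column removed, and let $W\in\mathbb{R}^{m\times(m-n+1)}$ have orthonormal columns spanning the orthogonal complement of the column space of $[U_r^{(d)}]_{-k}$. If $u\in\mathbb{R}^{m-n+1}$ is a unit eigenvector of $W^{\mathrm T}S_{r,k}W$ for its smallest eigenvalue, then $Wu$ is an optimal choice of the $k$-th column $[U_r^{(d)}]_k$ for the problem of minimizing $[U_r^{(d)}]_k^{\mathrm T}S_{r,k}[U_r^{(d)}]_k$ subject to $(U_r^{(d)})^{\mathrm T}U_r^{(d)}=I_n$.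
   Context: A system tuple $(A,C)$ has $A\in\mathbb{R}^{n\times n}$ strictly stable and $C\in\mathbb{R}^{m\times n}$ with $C^{\mathrm T}C=I_n$. For symmetric $A$ a canonical tuple is $(\Lambda,U)$ with $\Lambda=P^{\mathrm T}AP$ diagonal, $U=CP$, $P$ orthogonal. Data systems $X_1,\dots,X_N$ have canonical tuples $(\Lambda_i^{(x)},U_i^{(x)})$; dictionary atoms $D_1,\dots,D_J$ have canonical tuples $(\Lambda_j^{(d)},U_j^{(d)})$; $z_{j,i}$ are real codes. Notation: $[X]_k$ is the $k$-th column of $X$, or the $k$-th diagonal entry if $X$ is diagonal. For $\lambda$ and diagonal $\Lambda$ with entries $\lambda_1,\dots,\lambda_n$, $E(\lambda,\Lambda)=\mathrm{diag}\Big(\frac{(1-|\lambda|^2)(1-|\lambda_l|^2)}{|1-\lambda\lambda_l^{*}|^2}\Big)_{l=1}^n$. Set $F_{r,j,k}=U_j^{(d)}E([\Lambda_r^{(d)}]_k,\Lambda_j^{(d)})(U_j^{(d)})^{\mathrm T}$, $F'_{r,i,k}=U_i^{(x)}E([\Lambda_r^{(d)}]_k,\Lambda_i^{(x)})(U_i^{(x)})^{\mathrm T}$, and $S_{r,k}=\sum_{i=1}^N z_{r,i}\big(\sum_{j\ne r}z_{j,i}F_{r,j,k}-F'_{r,i,k}\big)$ (an $m\times m$ real matrix). *)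

theory Defs
  imports "HOL-Analysis.Analysis"
begin

text \<open>Strict (discrete-time) stability: every complex eigenvalue of the real matrix A
  has modulus strictly less than one.\<close>
definition strictly_stable :: "real^'n^'n \<Rightarrow> bool" where
  "strictly_stable A \<longleftrightarrow>
     (\<forall>(v::complex^'n) (l::complex). v \<noteq> 0 \<and>
        (\<chi> i j. complex_of_real (A$i$j)) *v v = (\<chi> i. l * v$i) \<longrightarrow> cmod l < 1)"

definition is_diagonal :: "real^'n^'n \<Rightarrow> bool" where
  "is_diagonal L \<longleftrightarrow> (\<forall>i j. i \<noteq> j \<longrightarrow> L$i$j = 0)"

text \<open>(L, U) is the canonical tuple of a system tuple (A, C) with symmetric,
  strictly stable A and C^T C = I, i.e. L = P^T A P diagonal, U = C P, P orthogonal.\<close>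
definition canonical_tuple :: "real^'n^'n \<Rightarrow> real^'n^'m \<Rightarrow> bool" where
  "canonical_tuple L U \<longleftrightarrow>
     (\<exists>(A::real^'n^'n) (C::real^'n^'m) (P::real^'n^'n).
        transpose A = A \<and> strictly_stable A \<and> transpose C ** C = mat 1 \<and>
        orthogonal_matrix P \<and> L = transpose P ** A ** P \<and> is_diagonal L \<and> U = C ** P)"

text \<open>E(lambda, Lambda) for real lambda and real diagonal Lambda.\<close>
definition Emat :: "real \<Rightarrow> real^'n^'n \<Rightarrow> real^'n^'n" where
  "Emat lam L = (\<chi> i j. if i = j then
      ((1 - \<bar>lam\<bar>^2) * (1 - \<bar>L$i$i\<bar>^2)) / \<bar>1 - lam * L$i$i\<bar>^2 else 0)"

text \<open>F_{r,j,k} = U_j E([Lambda_r]_k, Lambda_j) U_j^T  (same shape for F').\<close>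
definition Fmat :: "real^'n^'n \<Rightarrow> 'n \<Rightarrow> real^'n^'n \<Rightarrow> real^'n^'m \<Rightarrow> real^'m^'m" where
  "Fmat Lr k L U = U ** Emat (Lr$k$k) L ** transpose U"

text \<open>S_{r,k} = sum_i z_{r,i} (sum_{j \<noteq> r} z_{j,i} F_{r,j,k} - F'_{r,i,k}),
  atoms indexed by 1..J, data by 1..N, codes z j i.\<close>
definition Smat ::
  "nat \<Rightarrow> nat \<Rightarrow> (nat \<Rightarrow> real^'n^'n) \<Rightarrow> (nat \<Rightarrow> real^'n^'m) \<Rightarrow>
   (nat \<Rightarrow> real^'n^'n) \<Rightarrow> (nat \<Rightarrow> real^'n^'m) \<Rightarrow> (nat \<Rightarrow> nat \<Rightarrow> real) \<Rightarrow>
   nat \<Rightarrow> 'n \<Rightarrow> real^'m^'m" where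
  "Smat N J Ld Ud Lx Ux z r k =
     (\<Sum>i\<in>{1..N}. z r i *\<^sub>R
        ((\<Sum>j\<in>{1..J} - {r}. z j i *\<^sub>R Fmat (Ld r) k (Ld j) (Ud j))
          - Fmat (Ld r) k (Lx i) (Ux i)))"

text \<open>Replace the k-th column of U by x.\<close>
definition replace_col :: "real^'n^'m \<Rightarrow> 'n \<Rightarrow> real^'m \<Rightarrow> real^'n^'m" where
  "replace_col U k x = (\<chi> i l. if l = k then x$i else U$i$l)"

end

theory Submission
  imports Defs
begin

text \<open>Orthonormality of the new column set only asks that the \<open>k\<close>-th column be a unit vector
  orthogonal to the other columns, i.e. a unit vector of the range of the isometry \<open>W\<close>.
  Writing it as \<open>W c\<close> with \<open>\<parallel>c\<parallel> = 1\<close> turns the objective into the Rayleigh quotient of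
  the symmetric matrix \<open>W\<^sup>T S W\<close>, and a minimiser of a symmetric quadratic form on the unit
  sphere is an eigenvector, so the quotient is bounded below by the smallest eigenvalue,
  which is attained at \<open>u\<close>.\<close>

lemma inner_matrix_vector_mult_transpose:
  "(x::real^'n) \<bullet> (A *v y) = (transpose A *v x) \<bullet> y"
  by (metis dot_lmul_matrix transpose_matrix_vector transpose_transpose)

lemma transpose_sum:
  "transpose (sum (f::'i \<Rightarrow> real^'a^'b) A) = (\<Sum>i\<in>A. transpose (f i))"
  by (simp add: vec_eq_iff transpose_def sum_component)

lemma transpose_diff: "transpose ((A::real^'a^'b) - B) = transpose A - transpose B"
  by (simp add: vec_eq_iff transpose_def)

lemma transpose_Emat: "transpose (Emat lam L) = Emat lam L"
  by (simp add: vec_eq_iff transpose_def Emat_def)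

lemma transpose_Fmat: "transpose (Fmat Lr k L U) = Fmat Lr k L U"
  by (simp add: Fmat_def matrix_transpose_mul matrix_mul_assoc transpose_Emat)

lemma transpose_Smat: "transpose (Smat N J Ld Ud Lx Ux z r k) = Smat N J Ld Ud Lx Ux z r k"
  by (simp add: Smat_def transpose_sum transpose_scalar transpose_diff transpose_Fmat)

lemma canonical_tuple_orthonormal_columns:
  assumes "canonical_tuple L U"
  shows "transpose U ** U = mat 1"
proof -
  obtain C P where CP: "transpose C ** C = mat 1" "orthogonal_matrix P" "U = C ** P"
    using assms unfolding canonical_tuple_def by blast
  have "transpose U ** U = transpose P ** ((transpose C ** C) ** P)"
    by (simp add: CP(3) matrix_transpose_mul matrix_mul_assoc)
  also have "\<dots> = mat 1"
    using CP by (simp add: matrix_mul_lid orthogonal_matrix)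
  finally show ?thesis .
qed

lemma span_columns_eq_range: "span (columns (A::real^'n^'m)) = range ((*v) A)"
proof
  show "span (columns A) \<subseteq> range ((*v) A)"
  proof (rule span_minimal)
    show "columns A \<subseteq> range ((*v) A)"
      by (auto simp: columns_def simp flip: matrix_vector_mult_basis)
    show "subspace (range ((*v) A))"
      by (intro linear_subspace_image subspace_UNIV matrix_vector_mul_linear)
  qed
  show "range ((*v) A) \<subseteq> span (columns A)"
    using matrix_vector_mult_in_columnspace by blast
qed

lemma column_replace_col:
  "column l (replace_col U k x) = (if l = k then x else column l U)"
  by (simp add: vec_eq_iff column_def replace_col_def)

lemma orthonormal_replace_col_iff:
  assumes "transpose U ** U = mat 1"
  shows "transpose (replace_col U k x) ** replace_col U k x = mat 1 \<longleftrightarrow>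
    x \<bullet> x = 1 \<and> (\<forall>l. l \<noteq> k \<longrightarrow> column l U \<bullet> x = 0)"
proof -
  have U: "column a U \<bullet> column b U = (if a = b then 1 else 0)" for a b
    using assms unfolding matrix_mult_transpose_dot_column by (simp add: vec_eq_iff mat_def)
  show ?thesis
    unfolding matrix_mult_transpose_dot_column column_replace_col
    by (auto simp: vec_eq_iff mat_def U inner_commute split: if_splits)
qed

lemma isometry_inner:
  fixes W :: "real^'n^'m"
  assumes "transpose W ** W = mat 1"
  shows "(W *v c) \<bullet> (W *v c) = c \<bullet> c"
  using assms inner_matrix_vector_mult_transpose[of "W *v c" W c]
  by (simp add: matrix_vector_mul_assoc inner_commute)

lemma quadratic_form_congruence:
  fixes W :: "real^'n^'m"
  shows "(W *v c) \<bullet> (S *v (W *v c)) = c \<bullet> ((transpose W ** S ** W) *v c)"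
  by (simp add: inner_matrix_vector_mult_transpose[of "W *v c"] matrix_vector_mul_assoc
      inner_matrix_vector_mult_transpose[of c] matrix_transpose_mul matrix_mul_assoc)

lemma linear_coeff_zero_if_quadratic_nonneg:
  fixes b c :: real
  assumes "\<And>t. 0 \<le> 2*t*b + t^2*c"
  shows "b = 0"
proof (rule ccontr)
  assume "b \<noteq> 0"
  have "0 \<le> c" using assms[of 1] assms[of "-1"] by simp
  define s where "s = 1 / (c + 1)"
  have s: "0 < s" "s * c < 1" using \<open>0 \<le> c\<close> by (auto simp: s_def field_simps)
  have "2*(- b * s)*b + (- b * s)^2*c = b^2 * (s * (s*c - 2))"
    by (simp add: power2_eq_square algebra_simps)
  also have "\<dots> < 0" using \<open>b \<noteq> 0\<close> s by (intro mult_pos_neg) auto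
  finally show False using assms[of "- b * s"] by simp
qed

lemma symmetric_sphere_minimiser_is_eigenvector:
  fixes M :: "real^'n^'n"
  assumes sym: "transpose M = M"
    and v0: "norm v0 = 1"
    and min: "\<And>x. norm x = 1 \<Longrightarrow> v0 \<bullet> (M *v v0) \<le> x \<bullet> (M *v x)"
  shows "M *v v0 = (v0 \<bullet> (M *v v0)) *\<^sub>R v0"
proof -
  define m where "m = v0 \<bullet> (M *v v0)"
  have Msym: "x \<bullet> (M *v y) = y \<bullet> (M *v x)" for x y
    by (metis inner_matrix_vector_mult_transpose inner_commute sym)
  have homogeneous_min: "m * (x \<bullet> x) \<le> x \<bullet> (M *v x)" for x
  proof (cases "x = 0")
    case False
    have "m \<le> (x /\<^sub>R norm x) \<bullet> (M *v (x /\<^sub>R norm x))"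
      using False min[of "x /\<^sub>R norm x"] unfolding m_def by simp
    also have "\<dots> = (x \<bullet> (M *v x)) / (x \<bullet> x)"
      by (simp add: matrix_vector_mult_scaleR power2_norm_eq_inner[symmetric] power2_eq_square
          divide_inverse inverse_mult_distrib mult_ac)
    finally show ?thesis
      using False by (simp add: pos_le_divide_eq)
  qed simp
  \<comment> \<open>\<open>B\<close> is a positive semidefinite form vanishing at \<open>v0\<close>, so \<open>v0\<close> lies in its kernel.\<close>
  define B where "B x y = x \<bullet> (M *v y) - m * (x \<bullet> y)" for x y
  have B_expand: "B (v0 + t *\<^sub>R w) (v0 + t *\<^sub>R w) = 2*t*B v0 w + t^2 * B w w" for t w
    using v0 Msym[of v0 w]
    by (simp add: B_def m_def norm_eq_1 matrix_vector_right_distrib matrix_vector_mult_scaleR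
        inner_add_left inner_add_right inner_commute[of w v0] algebra_simps power2_eq_square)
  have B_kernel: "B v0 w = 0" for w
    by (rule linear_coeff_zero_if_quadratic_nonneg[of _ "B w w"])
      (metis B_expand B_def homogeneous_min diff_ge_0_iff_ge)
  define w where "w = M *v v0 - m *\<^sub>R v0"
  have "w \<bullet> w = B v0 w"
    using Msym[of v0 w] by (simp add: B_def w_def inner_commute[of "M *v v0" v0]
        inner_diff_left inner_diff_right algebra_simps)
  then have "w = 0" using B_kernel by simp
  then show ?thesis by (simp add: w_def m_def)
qed

lemma min_eigenvalue_le_rayleigh_quotient:
  fixes M :: "real^'n^'n"
  assumes sym: "transpose M = M"
    and mu_min: "\<And>v nu. v \<noteq> 0 \<Longrightarrow> M *v v = nu *\<^sub>R v \<Longrightarrow> mu \<le> nu"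
    and x: "norm x = 1"
  shows "mu \<le> x \<bullet> (M *v x)"
proof -
  have "continuous_on (sphere 0 1) (\<lambda>x. x \<bullet> (M *v x))"
    by (intro continuous_intros linear_continuous_on matrix_vector_mult_linear_continuous_on)
  moreover have "sphere (0::real^'n) 1 \<noteq> {}"
    using x by auto
  ultimately obtain v0 where "v0 \<in> sphere 0 1"
    and "\<forall>y\<in>sphere 0 1. v0 \<bullet> (M *v v0) \<le> y \<bullet> (M *v y)"
    using continuous_attains_inf[OF compact_sphere] by blast
  then have v0: "norm v0 = 1"
    and min: "\<And>y. norm y = 1 \<Longrightarrow> v0 \<bullet> (M *v v0) \<le> y \<bullet> (M *v y)"
    by auto
  have "v0 \<noteq> 0" using v0 by auto
  then have "mu \<le> v0 \<bullet> (M *v v0)"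
    by (rule mu_min[OF _ symmetric_sphere_minimiser_is_eigenvector[OF sym v0 min]])
  also have "\<dots> \<le> x \<bullet> (M *v x)" using min x .
  finally show ?thesis .
qed

theorem theorem3:
  fixes N J r :: nat
    and Ld :: "nat \<Rightarrow> real^'n^'n" and Ud :: "nat \<Rightarrow> real^'n^'m"
    and Lx :: "nat \<Rightarrow> real^'n^'n" and Ux :: "nat \<Rightarrow> real^'n^'m"
    and z :: "nat \<Rightarrow> nat \<Rightarrow> real"
    and k :: 'n
    and W :: "real^'p^'m" and u :: "real^'p" and mu :: real
  assumes data: "\<And>i. i \<in> {1..N} \<Longrightarrow> canonical_tuple (Lx i) (Ux i)"
    and atoms: "\<And>j. j \<in> {1..J} \<Longrightarrow> canonical_tuple (Ld j) (Ud j)"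
    and r: "r \<in> {1..J}"
    and dimW: "CARD('p) = CARD('m) - CARD('n) + 1"
    and W_orth: "transpose W ** W = mat 1"
    and W_span: "span (columns W) = {x. \<forall>l. l \<noteq> k \<longrightarrow> column l (Ud r) \<bullet> x = 0}"
    and u_unit: "norm u = 1"
    and u_eig: "(transpose W ** Smat N J Ld Ud Lx Ux z r k ** W) *v u = mu *\<^sub>R u"
    and mu_min: "\<And>v nu. v \<noteq> 0 \<Longrightarrow>
        (transpose W ** Smat N J Ld Ud Lx Ux z r k ** W) *v v = nu *\<^sub>R v \<Longrightarrow> mu \<le> nu"
  shows "transpose (replace_col (Ud r) k (W *v u)) ** replace_col (Ud r) k (W *v u) = mat 1
    \<and> (\<forall>y. transpose (replace_col (Ud r) k y) ** replace_col (Ud r) k y = mat 1 \<longrightarrow>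
          (W *v u) \<bullet> (Smat N J Ld Ud Lx Ux z r k *v (W *v u))
            \<le> y \<bullet> (Smat N J Ld Ud Lx Ux z r k *v y))"
proof -
  define S where "S = Smat N J Ld Ud Lx Ux z r k"
  have M_sym: "transpose (transpose W ** S ** W) = transpose W ** S ** W"
    by (simp add: S_def transpose_Smat matrix_transpose_mul matrix_mul_assoc)
  have feasible_iff: "transpose (replace_col (Ud r) k y) ** replace_col (Ud r) k y = mat 1
      \<longleftrightarrow> y \<bullet> y = 1 \<and> y \<in> range ((*v) W)" for y
    using orthonormal_replace_col_iff[OF canonical_tuple_orthonormal_columns[OF atoms[OF r]]]
    by (simp flip: span_columns_eq_range add: W_span)
  have optimal: "(W *v u) \<bullet> (S *v (W *v u)) \<le> (W *v c) \<bullet> (S *v (W *v c))"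
    if "(W *v c) \<bullet> (W *v c) = 1" for c
  proof -
    have "(W *v u) \<bullet> (S *v (W *v u)) = mu"
      using u_eig u_unit by (simp add: quadratic_form_congruence S_def norm_eq_1)
    also have "mu \<le> (W *v c) \<bullet> (S *v (W *v c))"
      unfolding quadratic_form_congruence
      using that mu_min isometry_inner[OF W_orth]
      by (intro min_eigenvalue_le_rayleigh_quotient[OF M_sym]) (auto simp: S_def norm_eq_1)
    finally show ?thesis .
  qed
  show ?thesis
    using u_unit isometry_inner[OF W_orth] optimal
    by (auto simp: feasible_iff norm_eq_1 simp flip: S_def)
qed

end
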